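(* Let $G=(V,E)$ be a finite DAG and let $\epsilon\ge 1$ be an integer. Let $L_{out}(v), L_{in}(v)\subseteq V$ ($v\in V$) be the labels produced by the Hierarchical-Labeling algorithm (as defined in the context) from any hierarchical DAG decomposition $G_0=G,G_1,\dots,G_h$ of $G$ with locality threshold $\epsilon$. Then the labeling is complete: for every pair of vertices $(u,v)$ of $G$, $$u\rightarrow v \ \text{ in } G \quad\text{iff}\quad L_{out}(u)\cap L_{in}(v)\neq\emptyset .$$
   Context: All graphs are finite directed acyclic graphs (DAGs) without self-loops. $u\rightarrow v$ means there is a directed path (possibly of length $0$, so $u\rightarrow u$) from $u$ to $v$. $d(u,v|H)$ is the number of edges of a shortest directed path from $u$ to $v$ in $H$ ($\infty$ if none, $0$ if $u=v$). One-side reachability backbone: given a DAG $H=(V_H,E_H)$ and an integer threshold $\epsilon\ge1$, a one-side reachability backbone of $H$ is a graph $H^\star=(V^\star,E^\star)$ such that (1) $V^\star\subseteq V_H$ and for any $u,v\in V_H$ with $d(u,v|H)=\epsilon$ there is $v^\star\in V^\star$ with $d(u,v^\star|H)\le\epsilon$ and $d(v^\star,v|H)\le\epsilon$; (2) $E^\star$ consists of the edges $(u^\star,v^\star)$ with $u^\star\ne v^\star$ in $V^\star$ and $d(u^\star,v^\star|H)\le\epsilon+1$. Hierarchical DAG decomposition of $G$ with threshold $\epsilon$: a vertex hierarchy $V_0=V\supset V_1\supset\cdots\supset V_h$ with edge sets $E_0=E,E_1,\dots,E_h$ such that, for $0<i\le h$, $G_i=(V_i,E_i)$ is a one-side reachability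 backbone (threshold $\epsilon$) of $G_{i-1}$. $G_h$ is called the core graph. For a vertex $v$ of $G_i$, $N^k_{out}(v|G_i)$ (resp. $N^k_{in}(v|G_i)$) is the set of vertices $x$ of $G_i$ with $d(v,x|G_i)\le k$ (resp. $d(x,v|G_i)\le k$); these contain $v$ itself. For $i<h$ and $v\in V_i\setminus V_{i+1}$, the backbone vertex sets are $$\mathcal B^\epsilon_{out}(v|G_i)=\{u\in V_{i+1}: d(v,u|G_i)\le\epsilon,\text{ and there is no } x\in V_{i+1},\ x\neq u,\text{ with } d(v,x|G_i)\le\epsilon \text{ and } d(x,u|G_i)\le\epsilon\},$$ $$\mathcal B^\epsilon_{in}(v|G_i)=\{u\in V_{i+1}: d(u,v|G_i)\le\epsilon,\text{ and there is no } y\in V_{i+1},\ y\neq u,\text{ with } d(u,y|G_i)\le\epsilon \text{ and } d(y,v|G_i)\le\epsilon\}.$$ Hierarchical-Labeling algorithm. Step 1: label the vertices of the core graph $G_h$ in one of two ways: (a) if every pair $u\rightarrow v$ in $G_h$ has $d(u,v|G_h)\le\epsilon$, set $L_{out}(v)=N_{out}^{\lceil\epsilon/2\rceil}(v|G_h)$ and $L_{in}(v)=N_{in}^{\lceil\epsilon/2\rceil}(v|G_h)$ for $v\in V_h$; or (b) use any existing $2$-hop labeling method on $G_h$, i.e. any labeling in which $L_{out}(v)$ consists of vertices of $G_h$ that $v$ reaches in $G_h$, $L_{in}(v)$ consists of vertices of $G_h$ that reach $v$ in $G_h$, each $v\in V_h$ is in both $L_{out}(v)$ and $L_{in}(v)$,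 and for all $u,v\in V_h$, $u\rightarrow v$ in $G_h$ implies $L_{out}(u)\cap L_{in}(v)\ne\emptyset$. Step 2: for $i=h-1,h-2,\dots,0$ in this order, for each $v\in V_i\setminus V_{i+1}$ set $$L_{out}(v)=N_{out}^{\lceil\epsilon/2\rceil}(v|G_i)\cup\bigcup_{u\in\mathcal B^\epsilon_{out}(v|G_i)}L_{out}(u),\qquad L_{in}(v)=N_{in}^{\lceil\epsilon/2\rceil}(v|G_i)\cup\bigcup_{u\in\mathcal B^\epsilon_{in}(v|G_i)}L_{in}(u).$$ *)

theory Defs
  imports Complex_Main "HOL-Library.Extended_Nat"
begin

text \<open>A directed graph is given by its vertex set and its edge relation, so that ``$u$ reaches $v$''
  is membership in the reflexive-transitive closure of the edge relation. Acyclicity is taken with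
  respect to the transitive closure and hence excludes self-loops.\<close>

definition finite_dag :: "'a set \<Rightarrow> 'a rel \<Rightarrow> bool" where
  "finite_dag V E \<longleftrightarrow> finite V \<and> E \<subseteq> V \<times> V \<and> acyclic E"

text \<open>The infimum of the empty set is \<^term>\<open>\<infinity>::enat\<close>: unreachable vertices are at infinite distance.\<close>

definition gdist :: "'a rel \<Rightarrow> 'a \<Rightarrow> 'a \<Rightarrow> enat" where
  "gdist E u v = (INF k\<in>{k. (u, v) \<in> E ^^ k}. enat k)"

definition one_side_backbone ::
  "nat \<Rightarrow> 'a set \<Rightarrow> 'a rel \<Rightarrow> 'a set \<Rightarrow> 'a rel \<Rightarrow> bool" where
  "one_side_backbone \<epsilon> V E V' E' \<longleftrightarrow>
     V' \<subseteq> V \<and>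
     (\<forall>u\<in>V. \<forall>v\<in>V. gdist E u v = enat \<epsilon> \<longrightarrow>
        (\<exists>w\<in>V'. gdist E u w \<le> enat \<epsilon> \<and> gdist E w v \<le> enat \<epsilon>)) \<and>
     E' = {(u, v). u \<in> V' \<and> v \<in> V' \<and> u \<noteq> v \<and> gdist E u v \<le> enat (\<epsilon> + 1)}"

text \<open>The inclusions \<^term>\<open>Vs (Suc i) \<subseteq> Vs i\<close> are part of the backbone condition; they are not
  required to be strict, which covers the strict case as well. The case \<^term>\<open>h = (0::nat)\<close>, where
  the core graph is the whole graph, is allowed.\<close>

definition hierarchical_decomposition ::
  "nat \<Rightarrow> 'a set \<Rightarrow> 'a rel \<Rightarrow> nat \<Rightarrow> (nat \<Rightarrow> 'a set) \<Rightarrow> (nat \<Rightarrow> 'a rel) \<Rightarrow> bool" where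
  "hierarchical_decomposition \<epsilon> V E h Vs Es \<longleftrightarrow>
     Vs 0 = V \<and> Es 0 = E \<and>
     (\<forall>i<h. one_side_backbone \<epsilon> (Vs i) (Es i) (Vs (Suc i)) (Es (Suc i)))"

definition nbh_out :: "nat \<Rightarrow> 'a set \<Rightarrow> 'a rel \<Rightarrow> 'a \<Rightarrow> 'a set" where
  "nbh_out k V E v = {x \<in> V. gdist E v x \<le> enat k}"

definition nbh_in :: "nat \<Rightarrow> 'a set \<Rightarrow> 'a rel \<Rightarrow> 'a \<Rightarrow> 'a set" where
  "nbh_in k V E v = {x \<in> V. gdist E x v \<le> enat k}"

text \<open>Below, \<^term>\<open>E\<close> is the edge relation of $G_i$ and \<^term>\<open>V'\<close> the vertex set of $G_{i+1}$.\<close>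

definition backbone_out :: "nat \<Rightarrow> 'a rel \<Rightarrow> 'a set \<Rightarrow> 'a \<Rightarrow> 'a set" where
  "backbone_out \<epsilon> E V' v =
     {u \<in> V'. gdist E v u \<le> enat \<epsilon> \<and>
        \<not> (\<exists>x\<in>V'. x \<noteq> u \<and> gdist E v x \<le> enat \<epsilon> \<and> gdist E x u \<le> enat \<epsilon>)}"

definition backbone_in :: "nat \<Rightarrow> 'a rel \<Rightarrow> 'a set \<Rightarrow> 'a \<Rightarrow> 'a set" where
  "backbone_in \<epsilon> E V' v =
     {u \<in> V'. gdist E u v \<le> enat \<epsilon> \<and>
        \<not> (\<exists>y\<in>V'. y \<noteq> u \<and> gdist E u y \<le> enat \<epsilon> \<and> gdist E y v \<le> enat \<epsilon>)}"

definition half_ceil :: "nat \<Rightarrow> nat" where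
  "half_ceil \<epsilon> = nat \<lceil>real \<epsilon> / 2\<rceil>"

definition two_hop_labeling ::
  "'a set \<Rightarrow> 'a rel \<Rightarrow> ('a \<Rightarrow> 'a set) \<Rightarrow> ('a \<Rightarrow> 'a set) \<Rightarrow> bool" where
  "two_hop_labeling V E Lout Lin \<longleftrightarrow>
     (\<forall>v\<in>V. Lout v \<subseteq> {x \<in> V. (v, x) \<in> E\<^sup>*} \<and> Lin v \<subseteq> {x \<in> V. (x, v) \<in> E\<^sup>*} \<and>
            v \<in> Lout v \<and> v \<in> Lin v) \<and>
     (\<forall>u\<in>V. \<forall>v\<in>V. (u, v) \<in> E\<^sup>* \<longrightarrow> Lout u \<inter> Lin v \<noteq> {})"

definition core_labeling ::
  "nat \<Rightarrow> 'a set \<Rightarrow> 'a rel \<Rightarrow> ('a \<Rightarrow> 'a set) \<Rightarrow> ('a \<Rightarrow> 'a set) \<Rightarrow> bool" where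
  "core_labeling \<epsilon> V E Lout Lin \<longleftrightarrow>
     ((\<forall>u\<in>V. \<forall>v\<in>V. (u, v) \<in> E\<^sup>* \<longrightarrow> gdist E u v \<le> enat \<epsilon>) \<and>
      (\<forall>v\<in>V. Lout v = nbh_out (half_ceil \<epsilon>) V E v \<and> Lin v = nbh_in (half_ceil \<epsilon>) V E v))
     \<or> two_hop_labeling V E Lout Lin"

text \<open>One pass of the labeling loop: the labels of the vertices in \<^term>\<open>Vs i - Vs (Suc i)\<close> are
  assigned, using the labels already computed for \<^term>\<open>Vs (Suc i)\<close>; all others are kept.\<close>

definition label_step_out ::
  "nat \<Rightarrow> (nat \<Rightarrow> 'a set) \<Rightarrow> (nat \<Rightarrow> 'a rel) \<Rightarrow> nat \<Rightarrow> ('a \<Rightarrow> 'a set) \<Rightarrow> 'a \<Rightarrow> 'a set" where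
  "label_step_out \<epsilon> Vs Es i L = (\<lambda>v.
     if v \<in> Vs i - Vs (Suc i)
     then nbh_out (half_ceil \<epsilon>) (Vs i) (Es i) v \<union> (\<Union>u\<in>backbone_out \<epsilon> (Es i) (Vs (Suc i)) v. L u)
     else L v)"

definition label_step_in ::
  "nat \<Rightarrow> (nat \<Rightarrow> 'a set) \<Rightarrow> (nat \<Rightarrow> 'a rel) \<Rightarrow> nat \<Rightarrow> ('a \<Rightarrow> 'a set) \<Rightarrow> 'a \<Rightarrow> 'a set" where
  "label_step_in \<epsilon> Vs Es i L = (\<lambda>v.
     if v \<in> Vs i - Vs (Suc i)
     then nbh_in (half_ceil \<epsilon>) (Vs i) (Es i) v \<union> (\<Union>u\<in>backbone_in \<epsilon> (Es i) (Vs (Suc i)) v. L u)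
     else L v)"

text \<open>The list \<^term>\<open>rev [0..<h]\<close> is $h-1, h-2, \ldots, 0$. The core labels \<^term>\<open>Cout\<close> and \<^term>\<open>Cin\<close>
  are constrained only on \<^term>\<open>Vs h\<close>; their values at the other vertices of the graph are overwritten
  by the loop before they are read.\<close>

definition hierarchical_labeling ::
  "nat \<Rightarrow> nat \<Rightarrow> (nat \<Rightarrow> 'a set) \<Rightarrow> (nat \<Rightarrow> 'a rel) \<Rightarrow>
   ('a \<Rightarrow> 'a set) \<Rightarrow> ('a \<Rightarrow> 'a set) \<Rightarrow> bool" where
  "hierarchical_labeling \<epsilon> h Vs Es Lout Lin \<longleftrightarrow>
     (\<exists>Cout Cin. core_labeling \<epsilon> (Vs h) (Es h) Cout Cin \<and>
        Lout = fold (label_step_out \<epsilon> Vs Es) (rev [0..<h]) Cout \<and>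
        Lin = fold (label_step_in \<epsilon> Vs Es) (rev [0..<h]) Cin)"

end

(* A labeling in which labels are sound, contain their own vertex and cover every reachable pair is
   a 2-hop labeling, and this property is pushed down the hierarchy: if it holds on the backbone, one
   pass of the loop establishes it on the graph below. A reachable pair of non-backbone vertices at
   distance at most epsilon meets at the midpoint of a shortest path. Every other reachable pair u, v
   is routed u -> w -> w' -> v through backbone vertices w, w' within epsilon of u and v; these can be
   moved to members of the backbone vertex sets of u and v by well-foundedness, and the backbone
   preserves reachability between its own vertices. *)

theory Submission
  imports Defs
begin

section \<open>Distances as lengths of paths\<close>

lemma gdist_le_iff: "gdist E u v \<le> enat k \<longleftrightarrow> (\<exists>j\<le>k. (u, v) \<in> E ^^ j)"
proof
  assume le: "gdist E u v \<le> enat k"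
  \<comment> \<open>A witness below an infimum is available only for a strict bound, hence the
    passage from \<open>k\<close> to \<open>Suc k\<close>.\<close>
  then have "gdist E u v < enat (Suc k)"
    by (metis enat_ord_simps(2) lessI order_le_less_trans)
  then obtain j where "(u, v) \<in> E ^^ j" "enat j < enat (Suc k)"
    unfolding gdist_def INF_less_iff by blast
  then show "\<exists>j\<le>k. (u, v) \<in> E ^^ j" using less_Suc_eq_le by auto
next
  assume "\<exists>j\<le>k. (u, v) \<in> E ^^ j"
  then obtain j where "j \<le> k" "(u, v) \<in> E ^^ j" by blast
  then show "gdist E u v \<le> enat k"
    unfolding gdist_def by (intro INF_lower2[of j]) auto
qed

lemma gdist_eq_iff:
  "gdist E u v = enat k \<longleftrightarrow> (u, v) \<in> E ^^ k \<and> (\<forall>j<k. (u, v) \<notin> E ^^ j)"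
proof -
  have "gdist E u v = enat k \<longleftrightarrow> gdist E u v \<le> enat k \<and> (\<forall>j<k. \<not> gdist E u v \<le> enat j)"
    by (cases "gdist E u v") (auto, meson le_neq_implies_less order_refl)
  also have "\<dots> \<longleftrightarrow> (u, v) \<in> E ^^ k \<and> (\<forall>j<k. (u, v) \<notin> E ^^ j)"
    unfolding gdist_le_iff by (auto dest: order_le_less_trans) (metis le_neq_implies_less order_refl)
  finally show ?thesis .
qed

lemma gdist_self_le: "gdist E u u \<le> enat k"
  unfolding gdist_le_iff by (intro exI[of _ 0]) simp

lemma gdist_le_imp_rtrancl: "gdist E u v \<le> enat k \<Longrightarrow> (u, v) \<in> E\<^sup>*"
  unfolding gdist_le_iff by (auto intro: relpow_imp_rtrancl)

lemma gdist_eq_imp_rtrancl: "gdist E u v = enat k \<Longrightarrow> (u, v) \<in> E\<^sup>*"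
  using gdist_le_imp_rtrancl[of E u v k] by simp

lemma rtrancl_gdist_obtain:
  assumes "(u, v) \<in> E\<^sup>*"
  obtains n where "gdist E u v = enat n"
proof -
  obtain k where "(u, v) \<in> E ^^ k" using assms rtrancl_imp_relpow by blast
  then have "gdist E u v \<le> enat k" unfolding gdist_le_iff by blast
  then show ?thesis using that by (cases "gdist E u v") auto
qed

lemma gdist_triangle:
  assumes "gdist E u w \<le> enat a" "gdist E w v \<le> enat b"
  shows "gdist E u v \<le> enat (a + b)"
proof -
  obtain i j where "i \<le> a" "(u, w) \<in> E ^^ i" "j \<le> b" "(w, v) \<in> E ^^ j"
    using assms unfolding gdist_le_iff by blast
  then have "i + j \<le> a + b" "(u, v) \<in> E ^^ (i + j)" by (auto simp: relpow_add)
  then show ?thesis unfolding gdist_le_iff by blast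
qed

text \<open>A path of minimal length is cut after \<open>a\<close> edges. Both pieces are themselves
  shortest, because a shorter replacement of either one would, by the triangle inequality, bring
  \<open>v\<close> closer to \<open>u\<close> than \<open>a + b\<close>.\<close>

lemma gdist_split:
  assumes "gdist E u v = enat (a + b)"
  obtains w where "gdist E u w = enat a" "gdist E w v = enat b"
proof -
  from assms obtain w where w: "(u, w) \<in> E ^^ a" "(w, v) \<in> E ^^ b"
    unfolding gdist_eq_iff by (auto simp: relpow_add)
  have minimal: "\<not> gdist E u v \<le> enat j" if "j < a + b" for j
    using assms that by simp
  have uw: "gdist E u w \<le> enat a" and wv: "gdist E w v \<le> enat b"
    using w unfolding gdist_le_iff by blast+
  have "a \<le> i" if "gdist E u w \<le> enat i" for i
    using gdist_triangle[OF that wv] minimal[of "i + b"] by linarith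
  moreover have "b \<le> j" if "gdist E w v \<le> enat j" for j
    using gdist_triangle[OF uw that] minimal[of "a + j"] by linarith
  ultimately show ?thesis
    using that uw wv by (cases "gdist E u w"; cases "gdist E w v") force+
qed

section \<open>Duality under edge reversal\<close>

lemma relpow_converse_iff:
  fixes E :: "'a rel"
  shows "(u, v) \<in> (E\<inverse>) ^^ k \<longleftrightarrow> (v, u) \<in> E ^^ k"
proof (induction k arbitrary: v)
  case (Suc k v)
  have "(u, v) \<in> (E\<inverse>) ^^ Suc k \<longleftrightarrow> (\<exists>w. (v, w) \<in> E \<and> (w, u) \<in> E ^^ k)"
    using Suc.IH by auto
  also have "\<dots> \<longleftrightarrow> (v, u) \<in> E ^^ Suc k"
    by (blast intro: relpow_Suc_I2 dest: relpow_Suc_D2)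
  finally show ?case .
qed auto

lemma gdist_converse: "gdist (E\<inverse>) u v = gdist E v u"
  unfolding gdist_def relpow_converse_iff ..

lemma nbh_in_eq_nbh_out_converse: "nbh_in k V E v = nbh_out k V (E\<inverse>) v"
  unfolding nbh_in_def nbh_out_def gdist_converse ..

lemma backbone_in_eq_backbone_out_converse: "backbone_in \<epsilon> E V' v = backbone_out \<epsilon> (E\<inverse>) V' v"
  unfolding backbone_in_def backbone_out_def gdist_converse by blast

text \<open>In-labels are out-labels of the reversed graph, so soundness and domination are proved
  for out-labels only and then instantiated with the converse relations.\<close>

lemma label_step_in_eq_label_step_out_converse:
  "label_step_in \<epsilon> Vs Es i L = label_step_out \<epsilon> Vs (\<lambda>i. (Es i)\<inverse>) i L"
  unfolding label_step_in_def label_step_out_def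
    nbh_in_eq_nbh_out_converse backbone_in_eq_backbone_out_converse ..

section \<open>Reachability and acyclicity in the backbone\<close>

lemma finite_dag_converse: "finite_dag V E \<Longrightarrow> finite_dag V (E\<inverse>)"
  unfolding finite_dag_def by auto

lemma finite_dag_wf: "finite_dag V E \<Longrightarrow> wf E"
  unfolding finite_dag_def by (metis finite_acyclic_wf finite_SigmaI finite_subset)

lemma finite_dag_rtrancl_mem: "finite_dag V E \<Longrightarrow> (u, v) \<in> E\<^sup>* \<Longrightarrow> u \<in> V \<Longrightarrow> v \<in> V"
  unfolding finite_dag_def by (auto elim: rtranclE)

lemma backbone_edges_subset_rtrancl:
  assumes "one_side_backbone \<epsilon> V E V' E'"
  shows "E'\<^sup>* \<subseteq> E\<^sup>*"
proof (rule rtrancl_subset_rtrancl)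
  show "E' \<subseteq> E\<^sup>*"
    using assms unfolding one_side_backbone_def by (auto dest: gdist_le_imp_rtrancl)
qed

text \<open>Backbone edges join distinct vertices, so each stands for a nonempty path of
  \<open>E\<close>, and a cycle of \<open>E'\<close> would unfold to a cycle of
  \<open>E\<close>.\<close>

lemma finite_dag_backbone:
  assumes dag: "finite_dag V E" and bb: "one_side_backbone \<epsilon> V E V' E'"
  shows "finite_dag V' E'"
proof -
  have "E' \<subseteq> E\<^sup>+"
    using bb unfolding one_side_backbone_def
    by (auto dest!: gdist_le_imp_rtrancl simp: rtrancl_eq_or_trancl)
  then have "acyclic E'"
    using dag unfolding finite_dag_def by (metis acyclic_def acyclic_subset trancl_id trans_trancl)
  then show ?thesis
    using dag bb finite_subset unfolding finite_dag_def one_side_backbone_def by blast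
qed

text \<open>Strong induction on the distance from \<open>u\<close> to \<open>v\<close>: a distance
  of at most \<epsilon> + 1 is covered by a single backbone edge or by \<open>u = v\<close>, and a
  longer one is shortened by a backbone edge to some \<open>w\<close> strictly closer to
  \<open>v\<close>.\<close>

lemma backbone_preserves_rtrancl:
  assumes dag: "finite_dag V E" and bb: "one_side_backbone \<epsilon> V E V' E'"
    and "u \<in> V'" "v \<in> V'" "(u, v) \<in> E\<^sup>*"
  shows "(u, v) \<in> E'\<^sup>*"
proof -
  from assms obtain n where "gdist E u v = enat n" by (blast elim: rtrancl_gdist_obtain)
  with \<open>u \<in> V'\<close> show ?thesis
  proof (induction n arbitrary: u rule: less_induct)
    case (less n)
    have edge: "(u, w) \<in> E'\<^sup>*" if "w \<in> V'" "gdist E u w \<le> enat (\<epsilon> + 1)" for w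
      using that less.prems(1) bb unfolding one_side_backbone_def by (cases "u = w") auto
    show ?case
    proof (cases "n \<le> \<epsilon> + 1")
      case True
      then show ?thesis using edge[OF \<open>v \<in> V'\<close>] less.prems(2) by simp
    next
      case False
      then obtain m where n: "n = 1 + (\<epsilon> + m)" by (metis add.assoc add.commute le_Suc_ex nat_le_linear)
      \<comment> \<open>The backbone condition is applied to the path without its first edge: applied at
        \<^term>\<open>u\<close> itself it could return \<^term>\<open>u\<close> and make no progress.\<close>
      obtain p where p: "gdist E u p = enat 1" "gdist E p v = enat (\<epsilon> + m)"
        using less.prems(2) n gdist_split by metis
      obtain q where q: "gdist E p q = enat \<epsilon>" "gdist E q v = enat m"
        using p(2) gdist_split by metis
      have "u \<in> V" using less.prems(1) bb unfolding one_side_backbone_def by blast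
      then have "p \<in> V" "q \<in> V"
        using p(1) q(1) by (blast intro: finite_dag_rtrancl_mem[OF dag] gdist_eq_imp_rtrancl)+
      then obtain w where w: "w \<in> V'" "gdist E p w \<le> enat \<epsilon>" "gdist E w q \<le> enat \<epsilon>"
        using bb q(1) unfolding one_side_backbone_def by blast
      \<comment> \<open>The first edge plus the \<epsilon> steps to \<open>w\<close> use up exactly
        the length allowed for a backbone edge.\<close>
      have "gdist E u w \<le> enat (\<epsilon> + 1)"
        using gdist_triangle[of E u p 1 w \<epsilon>] p(1) w(2) by (simp add: add.commute)
      then have "(u, w) \<in> E'\<^sup>*" using edge w(1) by blast
      moreover have "gdist E w v \<le> enat (\<epsilon> + m)"
        using gdist_triangle[OF w(3), of v m] q(2) by simp
      then obtain k where "gdist E w v = enat k" "k < n"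
        using n by (cases "gdist E w v") auto
      then have "(w, v) \<in> E'\<^sup>*" using less.IH w(1) by blast
      ultimately show ?thesis by (rule rtrancl_trans)
    qed
  qed
qed

section \<open>Backbone vertex sets and midpoints\<close>

text \<open>If \<open>w\<close> is excluded from the backbone vertex set, the excluding vertex
  \<open>x\<close> is also within \<epsilon> of \<open>v\<close> and is a proper ancestor of
  \<open>w\<close>; climbing to such ancestors stops by well-foundedness. Only reachability of
  \<open>w\<close> from \<open>y\<close> survives, not a bound on their distance.\<close>

lemma backbone_out_dominates:
  assumes dag: "finite_dag V E" and "w \<in> V'" "gdist E v w \<le> enat \<epsilon>"
  shows "\<exists>y\<in>backbone_out \<epsilon> E V' v. (y, w) \<in> E\<^sup>*"
  using wf_trancl[OF finite_dag_wf[OF dag]] assms(2,3)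
proof (induction w rule: wf_induct_rule)
  case (less w)
  show ?case
  proof (cases "w \<in> backbone_out \<epsilon> E V' v")
    case False
    then obtain x where x: "x \<in> V'" "x \<noteq> w" "gdist E v x \<le> enat \<epsilon>" "gdist E x w \<le> enat \<epsilon>"
      using less.prems unfolding backbone_out_def by blast
    then have "(x, w) \<in> E\<^sup>+"
      by (metis gdist_le_imp_rtrancl rtrancl_eq_or_trancl)
    then show ?thesis
      using less.IH[OF _ x(1,3)] by (meson rtrancl_trans trancl_into_rtrancl)
  qed blast
qed

lemma gdist_le_midpoint:
  assumes "gdist E u v \<le> enat \<epsilon>"
  obtains x where "gdist E u x \<le> enat (half_ceil \<epsilon>)" "gdist E x v \<le> enat (half_ceil \<epsilon>)"
proof -
  have half: "\<epsilon> \<le> half_ceil \<epsilon> + half_ceil \<epsilon>" unfolding half_ceil_def by linarith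
  obtain n where n: "gdist E u v = enat n" "n \<le> \<epsilon>"
    using assms by (cases "gdist E u v") auto
  \<comment> \<open>The minimum and the truncated subtraction also handle \<open>n\<close> below
    \<open>half_ceil \<epsilon>\<close>, where the midpoint is \<open>v\<close> itself.\<close>
  have "n = min n (half_ceil \<epsilon>) + (n - half_ceil \<epsilon>)" by simp
  then obtain x where "gdist E u x = enat (min n (half_ceil \<epsilon>))"
      "gdist E x v = enat (n - half_ceil \<epsilon>)"
    using n(1) gdist_split by metis
  then show ?thesis using n(2) half by (intro that[of x]) auto
qed

lemma nbh_out_inter_nbh_in:
  assumes dag: "finite_dag V E" and "u \<in> V" "gdist E u v \<le> enat \<epsilon>"
  shows "nbh_out (half_ceil \<epsilon>) V E u \<inter> nbh_in (half_ceil \<epsilon>) V E v \<noteq> {}"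
proof -
  obtain x where x: "gdist E u x \<le> enat (half_ceil \<epsilon>)" "gdist E x v \<le> enat (half_ceil \<epsilon>)"
    using assms(3) by (rule gdist_le_midpoint)
  then have "x \<in> V"
    using finite_dag_rtrancl_mem[OF dag] gdist_le_imp_rtrancl assms(2) by metis
  then show ?thesis using x unfolding nbh_out_def nbh_in_def by blast
qed

lemma nbh_out_self: "v \<in> V \<Longrightarrow> v \<in> nbh_out k V E v"
  unfolding nbh_out_def by (simp add: gdist_self_le)

lemma nbh_out_subset: "nbh_out k V E v \<subseteq> {x \<in> V. (v, x) \<in> E\<^sup>*}"
  unfolding nbh_out_def by (auto dest: gdist_le_imp_rtrancl)

text \<open>Option (b) is the claim itself. In option (a) every reachable pair is within \<epsilon>,
  so the two half-neighborhoods share a midpoint.\<close>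

lemma core_labeling_two_hop:
  assumes dag: "finite_dag V E" and core: "core_labeling \<epsilon> V E Lout Lin"
  shows "two_hop_labeling V E Lout Lin"
proof (cases "two_hop_labeling V E Lout Lin")
  case False
  with core have near: "\<forall>u\<in>V. \<forall>v\<in>V. (u, v) \<in> E\<^sup>* \<longrightarrow> gdist E u v \<le> enat \<epsilon>"
    and L: "\<forall>v\<in>V. Lout v = nbh_out (half_ceil \<epsilon>) V E v \<and> Lin v = nbh_in (half_ceil \<epsilon>) V E v"
    unfolding core_labeling_def by blast+
  have "Lin v \<subseteq> {x \<in> V. (x, v) \<in> E\<^sup>*}" "v \<in> Lin v" if "v \<in> V" for v
    using that L nbh_out_subset[of _ V "E\<inverse>" v] nbh_out_self[of v V _ "E\<inverse>"]
    by (auto simp: nbh_in_eq_nbh_out_converse rtrancl_converse)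
  moreover have "Lout v \<subseteq> {x \<in> V. (v, x) \<in> E\<^sup>*}" "v \<in> Lout v" if "v \<in> V" for v
    using that L nbh_out_subset[of _ V E v] nbh_out_self by auto
  moreover have "Lout u \<inter> Lin v \<noteq> {}" if "u \<in> V" "v \<in> V" "(u, v) \<in> E\<^sup>*" for u v
    using that near L nbh_out_inter_nbh_in[OF dag] by simp
  ultimately show ?thesis unfolding two_hop_labeling_def by simp
qed

section \<open>One pass of the labeling loop\<close>

text \<open>The labels on \<open>Vs (Suc i)\<close> are assumed sound for \<open>Es i\<close>, not
  for \<open>Es (Suc i)\<close>; inherited labels are then sound by transitivity, and the lemma
  applies to reversed edges as it stands.\<close>

lemma label_step_out_sound:
  assumes "Vs (Suc i) \<subseteq> Vs i"
    and L: "\<And>v. v \<in> Vs (Suc i) \<Longrightarrow> v \<in> L v \<and> L v \<subseteq> {x \<in> Vs i. (v, x) \<in> (Es i)\<^sup>*}"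
    and v: "v \<in> Vs i"
  shows "v \<in> label_step_out \<epsilon> Vs Es i L v \<and>
    label_step_out \<epsilon> Vs Es i L v \<subseteq> {x \<in> Vs i. (v, x) \<in> (Es i)\<^sup>*}"
proof (cases "v \<in> Vs (Suc i)")
  case True
  then show ?thesis using L unfolding label_step_out_def by simp
next
  case False
  have "L u \<subseteq> {x \<in> Vs i. (v, x) \<in> (Es i)\<^sup>*}" if "u \<in> backbone_out \<epsilon> (Es i) (Vs (Suc i)) v" for u
  proof -
    have "u \<in> Vs (Suc i)" "(v, u) \<in> (Es i)\<^sup>*"
      using that gdist_le_imp_rtrancl unfolding backbone_out_def by auto
    then show ?thesis using L by (blast intro: rtrancl_trans)
  qed
  then show ?thesis
    using False v nbh_out_self nbh_out_subset[of _ "Vs i" "Es i" v]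
    unfolding label_step_out_def by auto
qed

text \<open>Replaces a nearby backbone vertex \<open>w\<close> by an ancestor \<open>y\<close> whose
  whole label is contained in that of \<open>u\<close>. If \<open>u\<close> lies in the backbone its
  label is kept and \<open>y = u\<close> works.\<close>

lemma label_step_out_dominates:
  assumes dag: "finite_dag (Vs i) (Es i)" and "u \<in> Vs i"
    and w: "w \<in> Vs (Suc i)" "gdist (Es i) u w \<le> enat \<epsilon>"
  shows "\<exists>y\<in>Vs (Suc i). (y, w) \<in> (Es i)\<^sup>* \<and> L y \<subseteq> label_step_out \<epsilon> Vs Es i L u"
proof (cases "u \<in> Vs (Suc i)")
  case True
  then show ?thesis
    using gdist_le_imp_rtrancl[OF w(2)] unfolding label_step_out_def by auto
next
  case False
  obtain y where y: "y \<in> backbone_out \<epsilon> (Es i) (Vs (Suc i)) u" "(y, w) \<in> (Es i)\<^sup>*"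
    using backbone_out_dominates[OF dag w] by blast
  then have "y \<in> Vs (Suc i)" unfolding backbone_out_def by blast
  then show ?thesis
    using y False \<open>u \<in> Vs i\<close> unfolding label_step_out_def by auto
qed

text \<open>The covering condition is applied to the first \<epsilon> edges of a shortest path from
  \<open>u\<close>, and then to the last \<epsilon> edges of a shortest path from the vertex
  \<open>w\<close> so obtained. \<open>far\<close> excludes close pairs outside the backbone, which
  need not have a backbone vertex between them.\<close>

lemma route_through_backbone:
  assumes dag: "finite_dag V E" and bb: "one_side_backbone \<epsilon> V E V' E'"
    and uv: "u \<in> V" "v \<in> V" "(u, v) \<in> E\<^sup>*"
    and far: "u \<in> V' \<or> v \<in> V' \<or> \<not> gdist E u v \<le> enat \<epsilon>"
  obtains w w' where "w \<in> V'" "gdist E u w \<le> enat \<epsilon>" "(w, w') \<in> E\<^sup>*" "w' \<in> V'" "gdist E w' v \<le> enat \<epsilon>"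
proof -
  have cover: "\<exists>w\<in>V'. gdist E x w \<le> enat \<epsilon> \<and> gdist E w y \<le> enat \<epsilon>"
    if "x \<in> V" "y \<in> V" "gdist E x y = enat \<epsilon>" for x y
    using that bb unfolding one_side_backbone_def by blast
  have mem: "y \<in> V" if "x \<in> V" "gdist E x y = enat k" for x y k
    using that by (blast intro: finite_dag_rtrancl_mem[OF dag] gdist_eq_imp_rtrancl)
  have long: "\<exists>k. gdist E x y = enat (\<epsilon> + k)"
    if "(x, y) \<in> E\<^sup>*" "\<not> gdist E x y \<le> enat \<epsilon>" for x y
  proof -
    obtain n where n: "gdist E x y = enat n" using \<open>(x, y) \<in> E\<^sup>*\<close> by (rule rtrancl_gdist_obtain)
    then have "n = \<epsilon> + (n - \<epsilon>)" using that(2) by simp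
    then show ?thesis using n by metis
  qed
  have "\<exists>w\<in>V'. gdist E u w \<le> enat \<epsilon> \<and> (w, v) \<in> E\<^sup>*"
  proof (cases "u \<in> V'")
    case True
    then show ?thesis using uv(3) by (intro bexI[of _ u]) (simp_all add: gdist_self_le)
  next
    case not_u: False
    show ?thesis
    proof (cases "gdist E u v \<le> enat \<epsilon>")
      case True
      then show ?thesis using far not_u by (intro bexI[of _ v]) auto
    next
      case False
      then obtain k where "gdist E u v = enat (\<epsilon> + k)" using long uv(3) by blast
      then obtain q where q: "gdist E u q = enat \<epsilon>" "gdist E q v = enat k" by (rule gdist_split)
      then obtain w where "w \<in> V'" "gdist E u w \<le> enat \<epsilon>" "gdist E w q \<le> enat \<epsilon>"
        using cover mem uv(1) by blast
      moreover have "(q, v) \<in> E\<^sup>*" using q(2) by (rule gdist_eq_imp_rtrancl)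
      ultimately show ?thesis by (meson gdist_le_imp_rtrancl rtrancl_trans)
    qed
  qed
  then obtain w where w: "w \<in> V'" "gdist E u w \<le> enat \<epsilon>" "(w, v) \<in> E\<^sup>*" by blast
  have "w \<in> V" using w(1) bb unfolding one_side_backbone_def by blast
  have "\<exists>w'\<in>V'. (w, w') \<in> E\<^sup>* \<and> gdist E w' v \<le> enat \<epsilon>"
  proof (cases "gdist E w v \<le> enat \<epsilon>")
    case True
    then show ?thesis using w(1) by blast
  next
    case False
    \<comment> \<open>The summands are swapped so that the split leaves a final segment of length
      \<epsilon>.\<close>
    then obtain k where "gdist E w v = enat (k + \<epsilon>)" using long w(3) by (metis add.commute)
    then obtain q where q: "gdist E w q = enat k" "gdist E q v = enat \<epsilon>" by (rule gdist_split)
    then obtain w' where "w' \<in> V'" "gdist E q w' \<le> enat \<epsilon>" "gdist E w' v \<le> enat \<epsilon>"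
      using cover mem \<open>w \<in> V\<close> uv(2) by blast
    moreover have "(w, q) \<in> E\<^sup>*" using q(1) by (rule gdist_eq_imp_rtrancl)
    ultimately show ?thesis by (meson gdist_le_imp_rtrancl rtrancl_trans)
  qed
  then show ?thesis using that w by blast
qed

lemma label_step_two_hop:
  assumes dag: "finite_dag (Vs i) (Es i)"
    and bb: "one_side_backbone \<epsilon> (Vs i) (Es i) (Vs (Suc i)) (Es (Suc i))"
    and hop: "two_hop_labeling (Vs (Suc i)) (Es (Suc i)) Lout Lin"
  shows "two_hop_labeling (Vs i) (Es i) (label_step_out \<epsilon> Vs Es i Lout) (label_step_in \<epsilon> Vs Es i Lin)"
    (is "two_hop_labeling _ _ ?Lout ?Lin")
proof -
  let ?Es = "\<lambda>i. (Es i)\<inverse>"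
  have sub: "Vs (Suc i) \<subseteq> Vs i" using bb unfolding one_side_backbone_def by blast
  note lift = subsetD[OF backbone_edges_subset_rtrancl[OF bb]]
  have "v \<in> ?Lout v \<and> ?Lout v \<subseteq> {x \<in> Vs i. (v, x) \<in> (Es i)\<^sup>*}" if "v \<in> Vs i" for v
    using hop lift sub unfolding two_hop_labeling_def
    by (intro label_step_out_sound[OF sub _ that]) blast
  moreover have "v \<in> ?Lin v \<and> ?Lin v \<subseteq> {x \<in> Vs i. (v, x) \<in> (?Es i)\<^sup>*}" if "v \<in> Vs i" for v
    unfolding label_step_in_eq_label_step_out_converse
    using hop lift sub unfolding two_hop_labeling_def
    by (intro label_step_out_sound[OF sub _ that]) (unfold rtrancl_converse, blast)
  moreover have "?Lout u \<inter> ?Lin v \<noteq> {}"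
    if uv: "u \<in> Vs i" "v \<in> Vs i" "(u, v) \<in> (Es i)\<^sup>*" for u v
  proof (cases "u \<in> Vs (Suc i) \<or> v \<in> Vs (Suc i) \<or> \<not> gdist (Es i) u v \<le> enat \<epsilon>")
    case True
    then obtain w w' where w: "w \<in> Vs (Suc i)" "gdist (Es i) u w \<le> enat \<epsilon>" "(w, w') \<in> (Es i)\<^sup>*"
        "w' \<in> Vs (Suc i)" "gdist (Es i) w' v \<le> enat \<epsilon>"
      using route_through_backbone[OF dag bb uv] by blast
    obtain y where y: "y \<in> Vs (Suc i)" "(y, w) \<in> (Es i)\<^sup>*" "Lout y \<subseteq> ?Lout u"
      using label_step_out_dominates[of Vs i Es, OF dag uv(1) w(1,2)] by blast
    \<comment> \<open>Domination in the reversed graph: \<open>z\<close> is a descendant of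
      \<open>w'\<close> whose in-label passes to \<open>v\<close>.\<close>
    obtain z where z: "z \<in> Vs (Suc i)" "(w', z) \<in> (Es i)\<^sup>*" "Lin z \<subseteq> ?Lin v"
      using label_step_out_dominates[of Vs i ?Es, OF finite_dag_converse[OF dag] uv(2) w(4)] w(5)
      unfolding label_step_in_eq_label_step_out_converse gdist_converse rtrancl_converse by blast
    have "(y, z) \<in> (Es i)\<^sup>*" using y(2) w(3) z(2) by (meson rtrancl_trans)
    then have "(y, z) \<in> (Es (Suc i))\<^sup>*"
      by (rule backbone_preserves_rtrancl[OF dag bb y(1) z(1)])
    \<comment> \<open>The common hop of \<open>y\<close> and \<open>z\<close> given by the backbone
      labeling is inherited by \<open>u\<close> and \<open>v\<close>.\<close>
    then have "Lout y \<inter> Lin z \<noteq> {}"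
      using hop y(1) z(1) unfolding two_hop_labeling_def by blast
    then show ?thesis using y(3) z(3) by blast
  next
    case False
    then have "nbh_out (half_ceil \<epsilon>) (Vs i) (Es i) u \<subseteq> ?Lout u"
      "nbh_in (half_ceil \<epsilon>) (Vs i) (Es i) v \<subseteq> ?Lin v"
      using uv unfolding label_step_out_def label_step_in_def by auto
    then show ?thesis using nbh_out_inter_nbh_in[OF dag uv(1), of v \<epsilon>] False by blast
  qed
  ultimately show ?thesis unfolding two_hop_labeling_def rtrancl_converse by blast
qed

section \<open>The whole loop and completeness\<close>

lemma label_loop_two_hop:
  assumes "finite_dag (Vs 0) (Es 0)"
    and "\<And>i. i < h \<Longrightarrow> one_side_backbone \<epsilon> (Vs i) (Es i) (Vs (Suc i)) (Es (Suc i))"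
    and "core_labeling \<epsilon> (Vs h) (Es h) Cout Cin"
  shows "two_hop_labeling (Vs 0) (Es 0)
    (fold (label_step_out \<epsilon> Vs Es) (rev [0..<h]) Cout)
    (fold (label_step_in \<epsilon> Vs Es) (rev [0..<h]) Cin)"
proof -
  have dag: "finite_dag (Vs i) (Es i)" if "i \<le> h" for i
    using that by (induction i) (use assms(1,2) finite_dag_backbone Suc_le_lessD in \<open>auto, blast\<close>)
  have "two_hop_labeling (Vs 0) (Es 0)
      (fold (label_step_out \<epsilon> Vs Es) (rev [0..<k]) L) (fold (label_step_in \<epsilon> Vs Es) (rev [0..<k]) L')"
    if "k \<le> h" "two_hop_labeling (Vs k) (Es k) L L'" for k L L'
    using that
  \<comment> \<open>The list for \<open>Suc k\<close> starts with \<open>k\<close>, so the remaining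
    passes act on labels already updated by that step; \<open>L\<close> and \<open>L'\<close> must
    therefore be general.\<close>
  proof (induction k arbitrary: L L')
    case (Suc k)
    then have "k < h" by simp
    then have "two_hop_labeling (Vs k) (Es k) (label_step_out \<epsilon> Vs Es k L) (label_step_in \<epsilon> Vs Es k L')"
      using label_step_two_hop[of Vs k Es, OF dag assms(2) Suc.prems(2)] by simp
    with \<open>k < h\<close> show ?case using Suc.IH by simp
  qed simp
  then show ?thesis using core_labeling_two_hop[OF dag assms(3)] by blast
qed

theorem theorem1:
  fixes V :: "'a set" and E :: "'a rel" and \<epsilon> h :: nat
    and Vs :: "nat \<Rightarrow> 'a set" and Es :: "nat \<Rightarrow> 'a rel"
    and Lout Lin :: "'a \<Rightarrow> 'a set"
  assumes "finite_dag V E"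
    and "\<epsilon> \<ge> 1"
    and "hierarchical_decomposition \<epsilon> V E h Vs Es"
    and "hierarchical_labeling \<epsilon> h Vs Es Lout Lin"
  shows "\<forall>u\<in>V. \<forall>v\<in>V. (u, v) \<in> E\<^sup>* \<longleftrightarrow> Lout u \<inter> Lin v \<noteq> {}"
proof -
  \<comment> \<open>Both directions follow from this invariant at level 0: covering yields a common
    hop, and soundness turns a common hop into a path.\<close>
  have hop: "two_hop_labeling V E Lout Lin"
    using assms(1,3,4) label_loop_two_hop[of Vs Es h \<epsilon>]
    unfolding hierarchical_decomposition_def hierarchical_labeling_def by auto
  show ?thesis
  proof (intro ballI iffI)
    fix u v
    assume uv: "u \<in> V" "v \<in> V"
    show "Lout u \<inter> Lin v \<noteq> {}" if "(u, v) \<in> E\<^sup>*"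
      using that hop uv unfolding two_hop_labeling_def by blast
    assume "Lout u \<inter> Lin v \<noteq> {}"
    then obtain x where "x \<in> Lout u" "x \<in> Lin v" by blast
    then have "(u, x) \<in> E\<^sup>*" "(x, v) \<in> E\<^sup>*"
      using hop uv unfolding two_hop_labeling_def by auto
    then show "(u, v) \<in> E\<^sup>*" by (rule rtrancl_trans)
  qed
qed

end
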